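(* Let $\sigma=\sigma_b=\begin{pmatrix}1&b&-b^2\\0&1&-2b\\0&0&1\end{pmatrix}$, $b\in\mathbb{C}$, be the family of inner automorphisms of $\mathfrak{sl}_2(\mathbb{C})$. As an affine variety, $\mathrm{Der}_{\sigma}(\mathfrak{sl}_2(\mathbb{C}))$ has two irreducible components $\mathcal{V}(\mathfrak{p}_1)$ and $\mathcal{V}(\mathfrak{p}_2)$, where $\mathcal{V}(\mathfrak{p}_1)=\mathrm{Der}(\mathfrak{sl}_2(\mathbb{C}))$ is three-dimensional and $\mathcal{V}(\mathfrak{p}_2)$ is two-dimensional, consisting of all pairs $(D,\sigma)$ of the form $$D=\begin{pmatrix}0&\frac{-a}{2}&\frac{ab}{2}\\0&0&a\\0&0&0\end{pmatrix}\quad\text{and}\quad\sigma=\begin{pmatrix}1&b&-b^2\\0&1&-2b\\0&0&1\end{pmatrix},\qquad a,b\in\mathbb{C}.$$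
   Context: $\mathfrak{sl}_2(\mathbb{C})$ has basis $e_1,e_2,e_3$ with $[e_1,e_2]=-e_1$, $[e_1,e_3]=2e_2$, $[e_2,e_3]=-e_3$. A linear map $D$ is represented by the matrix $M$ with $(D(e_1),D(e_2),D(e_3))=(e_1,e_2,e_3)M$; similarly for $\sigma$. For a fixed $\sigma$, a $(\sigma,1)$-derivation is a linear map $D$ with $D([x,y])=[D(x),\sigma(y)]+[x,D(y)]$ for all $x,y$. Since $\sigma=\sigma_b$ is parametrized by $b$, $\mathrm{Der}_\sigma(\mathfrak{sl}_2(\mathbb{C}))$ is here viewed as the affine variety of all pairs $(D,\sigma_b)$, $b\in\mathbb{C}$, where $D$ is a $(\sigma_b,1)$-derivation; writing the matrix of $D$ as $M=(a_{ij})^{t}_{3\times 3}$ (so $D(e_i)=\sum_j a_{ij}e_j$), the pair $(D,\sigma_b)$ is identified with the point $x_{ij}=a_{ij}$, $y=b$ of $\mathbb{C}^{10}$. Let $A=\mathbb{C}[x_{ij},y\mid 1\le i,j\le 3]$. Then $\mathfrak{p}_1$ is the ideal of $A$ generated by $x_{13},x_{22},x_{31},y,\ x_{11}+x_{33},\ x_{12}+2x_{23},\ x_{21}+\tfrac12x_{32}$, and $\mathfrak{p}_2$ is the ideal generated by $x_{11},x_{12},x_{13},x_{22},x_{23},x_{33},\ x_{21}+\tfrac12x_{32},\ x_{31}-\tfrac12x_{32}y$. $\mathcal{V}(\cdot)$ denotes the common zero set in $\mathbb{C}^{10}$. The derivation algebra $\mathrm{Der}(\mathfrak{sl}_2(\mathbb{C}))$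 is identified with the set of pairs $(D,\sigma_0)$ with $\sigma_0=I$ and $D$ a derivation. *)

theory Defs
  imports "HOL-Analysis.Analysis" "HOL-Library.Poly_Mapping"
begin

section \<open>The Lie algebra and its twisted derivations\<close>

text \<open>
  The vector \<open>x\<close> stands for \<open>x$1 e\<^sub>1 + x$2 e\<^sub>2 + x$3 e\<^sub>3\<close>; the bracket is the alternating bilinear
  extension of \<open>[e\<^sub>1,e\<^sub>2] = -e\<^sub>1\<close>, \<open>[e\<^sub>1,e\<^sub>3] = 2e\<^sub>2\<close>, \<open>[e\<^sub>2,e\<^sub>3] = -e\<^sub>3\<close>.  The lemmas below show
  that this is the algebra of traceless \<open>2 \<times> 2\<close> matrices with the commutator.
\<close>

type_synonym sl2 = "complex^3"

definition e_basis :: "3 \<Rightarrow> sl2" where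
  "e_basis i = axis i 1"

definition bracket :: "sl2 \<Rightarrow> sl2 \<Rightarrow> sl2" where
  "bracket x y = vector
     [- (x$1 * y$2 - x$2 * y$1), 2 * (x$1 * y$3 - x$3 * y$1), - (x$2 * y$3 - x$3 * y$2)]"

lemma bracket_basis:
  "bracket (e_basis 1) (e_basis 2) = - e_basis 1"
  "bracket (e_basis 1) (e_basis 3) = 2 *s e_basis 2"
  "bracket (e_basis 2) (e_basis 3) = - e_basis 3"
  by (simp_all add: bracket_def e_basis_def vec_eq_iff forall_3 axis_def vector_scalar_mult_def)

lemma bracket_bilinear:
  "bracket (x + x') y = bracket x y + bracket x' y" "bracket (c *s x) y = c *s bracket x y"
  "bracket x (y + y') = bracket x y + bracket x y'" "bracket x (c *s y) = c *s bracket x y"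
  by (simp_all add: bracket_def vector_scalar_mult_def vec_eq_iff forall_3 algebra_simps)

lemma bracket_self: "bracket x x = 0"
  by (simp add: bracket_def vec_eq_iff forall_3)

definition to_matrix :: "sl2 \<Rightarrow> complex^2^2" where
  "to_matrix x = vector [vector [x$2 / 2, x$1], vector [x$3, - (x$2 / 2)]]"

lemma to_matrix_bij: "bij_betw to_matrix UNIV {A. trace A = 0}"
proof (rule bij_betwI[where g = "\<lambda>A. vector [A$1$2, 2 * A$1$1, A$2$1]"])
  show "to_matrix \<in> UNIV \<rightarrow> {A. trace A = 0}"
    by (auto simp: to_matrix_def trace_def sum_2)
  show "to_matrix (vector [A$1$2, 2 * A$1$1, A$2$1]) = A" if "A \<in> {A. trace A = 0}" for A
    using that
    by (simp add: to_matrix_def trace_def sum_2 vec_eq_iff forall_2 add_eq_0_iff)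
qed (auto simp: to_matrix_def vec_eq_iff forall_3)

lemma to_matrix_linear:
  "to_matrix (x + y) = to_matrix x + to_matrix y"
  "to_matrix (c *s x) $ i $ j = c * to_matrix x $ i $ j"
proof -
  show "to_matrix (x + y) = to_matrix x + to_matrix y"
    by (simp add: to_matrix_def vec_eq_iff forall_2 add_divide_distrib)
  have "\<forall>i j. to_matrix (c *s x) $ i $ j = c * to_matrix x $ i $ j"
    by (simp add: to_matrix_def forall_2 vector_scalar_mult_def)
  then show "to_matrix (c *s x) $ i $ j = c * to_matrix x $ i $ j" by blast
qed

lemma to_matrix_bracket:
  "to_matrix (bracket x y) = to_matrix x ** to_matrix y - to_matrix y ** to_matrix x"
  by (simp add: to_matrix_def bracket_def matrix_matrix_mult_def vec_eq_iff forall_2 sum_2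
      field_simps)

definition derivation :: "(sl2 \<Rightarrow> sl2) \<Rightarrow> bool" where
  "derivation D \<longleftrightarrow> Vector_Spaces.linear (*s) (*s) D \<and>
     (\<forall>x y. D (bracket x y) = bracket (D x) y + bracket x (D y))"

text \<open>\<open>twisted_derivation \<sigma> D\<close>: \<open>D\<close> is a \<open>(\<sigma>,1)\<close>-derivation.\<close>

definition twisted_derivation :: "(sl2 \<Rightarrow> sl2) \<Rightarrow> (sl2 \<Rightarrow> sl2) \<Rightarrow> bool" where
  "twisted_derivation \<sigma> D \<longleftrightarrow> Vector_Spaces.linear (*s) (*s) D \<and>
     (\<forall>x y. D (bracket x y) = bracket (D x) (\<sigma> y) + bracket x (D y))"

definition exp_ad :: "sl2 \<Rightarrow> sl2 \<Rightarrow> sl2" where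
  "exp_ad x y = suminf (\<lambda>n. (1 / fact n) *s ((bracket x ^^ n) y))"

text \<open>
  Inner automorphisms are the members of the group generated by all \<open>exp (ad x)\<close>; closure under
  inverses is automatic since \<open>exp (ad (-x))\<close> is inverse to \<open>exp (ad x)\<close>.
\<close>

inductive_set inner_automorphisms :: "(sl2 \<Rightarrow> sl2) set" where
  exp_ad: "exp_ad x \<in> inner_automorphisms"
| comp: "f \<in> inner_automorphisms \<Longrightarrow> g \<in> inner_automorphisms \<Longrightarrow> f \<circ> g \<in> inner_automorphisms"

definition sigma :: "complex \<Rightarrow> sl2 \<Rightarrow> sl2" where
  "sigma b = (*v) (vector
     [vector [1, b, - (b^2)],
      vector [0, 1, - 2 * b],
      vector [0, 0, 1]])"

lemma sigma_0: "sigma 0 = id"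
  by (simp add: sigma_def fun_eq_iff matrix_vector_mult_def vec_eq_iff forall_3 sum_3)

lemma sigma_eq_exp_ad: "sigma b = exp_ad (- b *s e_basis 1)"
proof
  fix y
  let ?f = "\<lambda>n. (bracket (- b *s e_basis 1) ^^ n) y"
  have three: "?f 3 = 0"
    by (simp add: numeral_3_eq_3 bracket_def e_basis_def axis_def vector_scalar_mult_def vec_eq_iff
        forall_3)
  have step: "?f (Suc n) = bracket (- b *s e_basis 1) (?f n)" for n by simp
  have bracket_0: "bracket x 0 = 0" for x by (simp add: bracket_def vec_eq_iff forall_3)
  have shift: "?f (k + 3) = 0" for k
    by (induction k) (simp_all only: add_0 add_Suc three step bracket_0)
  have zero: "?f n = 0" if "n \<notin> {0, 1, 2}" for n
  proof -
    from that have "n = (n - 3) + 3" by simp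
    with shift[of "n - 3"] show ?thesis by simp
  qed
  have "exp_ad (- b *s e_basis 1) y = (\<Sum>n\<in>{0, 1, 2}. (1 / fact n) *s ?f n)"
    unfolding exp_ad_def by (rule suminf_finite) (use zero in simp_all)
  also have "\<dots> = sigma b y"
    by (simp add: sigma_def numeral_2_eq_2 bracket_def e_basis_def axis_def vector_scalar_mult_def
        matrix_vector_mult_def sum_3 vec_eq_iff forall_3 power2_eq_square algebra_simps)
  finally show "sigma b y = exp_ad (- b *s e_basis 1) y" by simp
qed

definition Der_sigma :: "((sl2 \<Rightarrow> sl2) \<times> (sl2 \<Rightarrow> sl2)) set" where
  "Der_sigma = {(D, sigma b) | D b. twisted_derivation (sigma b) D}"

definition Der :: "((sl2 \<Rightarrow> sl2) \<times> (sl2 \<Rightarrow> sl2)) set" where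
  "Der = {(D, sigma 0) | D. derivation D}"

section \<open>Polynomials, zero sets and the Zariski topology\<close>

text \<open>
  \<open>'x mpoly\<close> is the polynomial ring over \<open>\<complex>\<close> in the indeterminates \<open>'x\<close>: finitely supported
  functions from monomials (finitely supported exponent functions) to coefficients, with the
  convolution product of Poly_Mapping.
\<close>

type_synonym 'x mpoly = "('x \<Rightarrow>\<^sub>0 nat) \<Rightarrow>\<^sub>0 complex"

definition Const :: "complex \<Rightarrow> 'x mpoly" where
  "Const c = Poly_Mapping.single 0 c"

definition Var :: "'x \<Rightarrow> 'x mpoly" where
  "Var v = Poly_Mapping.single (Poly_Mapping.single v 1) 1"

definition eval_monom :: "('x \<Rightarrow>\<^sub>0 nat) \<Rightarrow> ('x \<Rightarrow> complex) \<Rightarrow> complex" where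
  "eval_monom m a = (\<Prod>v\<in>Poly_Mapping.keys m. a v ^ Poly_Mapping.lookup m v)"

definition eval_poly :: "'x mpoly \<Rightarrow> ('x \<Rightarrow> complex) \<Rightarrow> complex" where
  "eval_poly p a = (\<Sum>m\<in>Poly_Mapping.keys p. Poly_Mapping.lookup p m * eval_monom m a)"

text \<open>The ideal generated by a set is the submodule it spans in the ring over itself.\<close>

definition ideal_gen :: "'x mpoly set \<Rightarrow> 'x mpoly set" where
  "ideal_gen S = module.span (*) S"

lemma ideal_gen_explicit:
  "ideal_gen S = {\<Sum>g\<in>G. h g * g | G h. finite G \<and> G \<subseteq> S}"
proof -
  interpret module "(*) :: 'a mpoly \<Rightarrow> 'a mpoly \<Rightarrow> 'a mpoly"
    by unfold_locales (simp_all add: algebra_simps)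
  show ?thesis by (simp add: ideal_gen_def span_explicit)
qed

definition zero_locus :: "'x mpoly set \<Rightarrow> ('x \<Rightarrow> complex) set" where
  "zero_locus S = {a. \<forall>p\<in>S. eval_poly p a = 0}"

definition zariski :: "('x \<Rightarrow> complex) topology" where
  "zariski = topology (\<lambda>U. \<exists>S. U = - zero_locus S)"

lemma eval_monom_superset:
  assumes "finite V" "Poly_Mapping.keys m \<subseteq> V"
  shows "eval_monom m a = (\<Prod>v\<in>V. a v ^ Poly_Mapping.lookup m v)"
  unfolding eval_monom_def by (rule prod.mono_neutral_left) (use assms in \<open>auto simp: in_keys_iff\<close>)

lemma eval_poly_superset:
  assumes "finite M" "Poly_Mapping.keys p \<subseteq> M"
  shows "eval_poly p a = (\<Sum>m\<in>M. Poly_Mapping.lookup p m * eval_monom m a)"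
  unfolding eval_poly_def by (rule sum.mono_neutral_left) (use assms in \<open>auto simp: in_keys_iff\<close>)

lemma eval_monom_add: "eval_monom (m + n) a = eval_monom m a * eval_monom n a"
proof -
  let ?V = "Poly_Mapping.keys m \<union> Poly_Mapping.keys n"
  have "Poly_Mapping.keys (m + n) \<subseteq> ?V" by (rule Poly_Mapping.keys_add)
  then show ?thesis
    by (subst (1 2 3) eval_monom_superset[of ?V])
      (auto simp: lookup_add power_add prod.distrib)
qed

lemma eval_poly_add: "eval_poly (p + q) a = eval_poly p a + eval_poly q a"
proof -
  let ?M = "Poly_Mapping.keys p \<union> Poly_Mapping.keys q"
  have "Poly_Mapping.keys (p + q) \<subseteq> ?M" by (rule Poly_Mapping.keys_add)
  then show ?thesis
    by (subst (1 2 3) eval_poly_superset[of ?M])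
      (auto simp: lookup_add distrib_right sum.distrib)
qed

lemma eval_poly_single: "eval_poly (Poly_Mapping.single m c) a = c * eval_monom m a"
  by (subst eval_poly_superset[of "{m}"]) auto

lemma eval_poly_Const: "eval_poly (Const c) a = c"
  by (simp add: Const_def eval_poly_single eval_monom_def)

lemma eval_poly_Var: "eval_poly (Var v) a = a v"
  by (simp add: Var_def eval_poly_single eval_monom_def)

lemma mpoly_induct [case_names single add]:
  assumes "\<And>m c. P (Poly_Mapping.single m c)" and "\<And>p q. P p \<Longrightarrow> P q \<Longrightarrow> P (p + q)"
  shows "P (p :: 'x mpoly)"
proof (induction p rule: update_induct)
  case const
  then show ?case using assms(1)[of 0 0] by simp
next
  case (update p m c)
  have "Poly_Mapping.update m c p = p + Poly_Mapping.single m c"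
    using update by (intro poly_mapping_eqI)
      (auto simp: lookup_update lookup_add lookup_single in_keys_iff when_def)
  then show ?case using assms update by simp
qed

lemma eval_poly_mult: "eval_poly (p * q) a = eval_poly p a * eval_poly q a"
proof (induction p rule: mpoly_induct)
  case (single m c)
  show ?case
    by (induction q rule: mpoly_induct)
      (simp_all add: mult_single eval_poly_single eval_monom_add distrib_left eval_poly_add)
next
  case (add p1 p2)
  then show ?case by (simp add: distrib_right eval_poly_add)
qed

lemma zero_locus_Un: "zero_locus S \<union> zero_locus T = zero_locus {p * q | p q. p \<in> S \<and> q \<in> T}"
proof (intro set_eqI iffI)
  fix a assume a: "a \<in> zero_locus {p * q | p q. p \<in> S \<and> q \<in> T}"
  show "a \<in> zero_locus S \<union> zero_locus T"
  proof (rule ccontr)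
    assume "a \<notin> zero_locus S \<union> zero_locus T"
    then obtain p q where pq: "p \<in> S" "q \<in> T" "eval_poly p a \<noteq> 0" "eval_poly q a \<noteq> 0"
      by (auto simp: zero_locus_def)
    then have "p * q \<in> {p * q | p q. p \<in> S \<and> q \<in> T}" by blast
    with a have "eval_poly (p * q) a = 0" by (simp only: zero_locus_def mem_Collect_eq Ball_def)
    with pq show False by (simp add: eval_poly_mult)
  qed
qed (auto simp: zero_locus_def eval_poly_mult)

lemma istopology_zariski: "istopology (\<lambda>U :: ('x \<Rightarrow> complex) set. \<exists>S. U = - zero_locus S)"
  unfolding istopology_def
proof (intro conjI allI impI)
  fix U U' :: "('x \<Rightarrow> complex) set"
  assume "\<exists>S. U = - zero_locus S" "\<exists>S. U' = - zero_locus S"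
  then show "\<exists>S. U \<inter> U' = - zero_locus S"
    by (auto simp flip: Compl_Un simp: zero_locus_Un)
next
  fix \<K> :: "('x \<Rightarrow> complex) set set"
  assume "\<forall>U\<in>\<K>. \<exists>S. U = - zero_locus S"
  then have "\<exists>S. \<forall>U\<in>\<K>. U = - zero_locus (S U)" by (rule bchoice)
  then obtain S where S: "\<And>U. U \<in> \<K> \<Longrightarrow> U = - zero_locus (S U)" by blast
  have "\<Union>\<K> = (\<Union>U\<in>\<K>. - zero_locus (S U))" using S by blast
  also have "\<dots> = - zero_locus (\<Union>U\<in>\<K>. S U)" by (auto simp: zero_locus_def)
  finally show "\<exists>S. \<Union>\<K> = - zero_locus S" by blast
qed

lemma openin_zariski: "openin zariski U \<longleftrightarrow> (\<exists>S. U = - zero_locus S)"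
  unfolding zariski_def by (simp add: topology_inverse'[OF istopology_zariski])

lemma topspace_zariski: "topspace zariski = UNIV"
proof -
  have "openin zariski (UNIV :: ('x \<Rightarrow> complex) set)"
    unfolding openin_zariski
    by (rule exI[of _ "{Const 1}"]) (simp add: zero_locus_def eval_poly_Const)
  then show ?thesis using openin_subset by blast
qed

lemma closedin_zariski: "closedin zariski Z \<longleftrightarrow> (\<exists>S. Z = zero_locus S)"
  by (simp add: closedin_def topspace_zariski openin_zariski Compl_eq_Diff_UNIV[symmetric])

section \<open>Irreducible components and dimension of a topological space\<close>

definition irreducible_space :: "'a topology \<Rightarrow> bool" where
  "irreducible_space T \<longleftrightarrow> topspace T \<noteq> {} \<and>
     (\<forall>C C'. closedin T C \<and> closedin T C' \<and> C \<union> C' = topspace T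
        \<longrightarrow> C = topspace T \<or> C' = topspace T)"

definition irreducible_subset :: "'a topology \<Rightarrow> 'a set \<Rightarrow> bool" where
  "irreducible_subset T Z \<longleftrightarrow> Z \<subseteq> topspace T \<and> irreducible_space (subtopology T Z)"

definition irreducible_components :: "'a topology \<Rightarrow> 'a set set" where
  "irreducible_components T =
     {Z. irreducible_subset T Z \<and> (\<forall>W. irreducible_subset T W \<and> Z \<subseteq> W \<longrightarrow> W = Z)}"

text \<open>
  The supremum of the lengths \<open>n\<close> of chains \<open>Z\<^sub>0 \<subset> \<dots> \<subset> Z\<^sub>n\<close> of irreducible closed subsets.
  (The empty space gets dimension \<open>0\<close>.)
\<close>

definition krull_dim :: "'a topology \<Rightarrow> enat" where
  "krull_dim T = Sup {enat n | n. \<exists>Z :: nat \<Rightarrow> 'a set.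
     (\<forall>i\<le>n. closedin T (Z i) \<and> irreducible_subset T (Z i)) \<and> (\<forall>i<n. Z i \<subset> Z (Suc i))}"

section \<open>The variety of pairs in \<open>\<complex>\<^sup>1\<^sup>0\<close>\<close>

datatype coord = X 3 3 | Y

text \<open>
  Here \<open>D(e\<^sub>i) = \<Sum>\<^sub>j a\<^sub>i\<^sub>j e\<^sub>j\<close>, so \<open>a\<^sub>i\<^sub>j\<close> is an entry of the \<^emph>\<open>transposed\<close> matrix of \<open>D\<close>,
  and \<open>b\<close> is read off from \<open>\<sigma>\<^sub>b\<close> as its \<open>(1,2)\<close> entry.
\<close>

definition coords :: "(sl2 \<Rightarrow> sl2) \<times> (sl2 \<Rightarrow> sl2) \<Rightarrow> coord \<Rightarrow> complex" where
  "coords = (\<lambda>(D, \<sigma>) v. case v of X i j \<Rightarrow> transpose (matrix D) $ i $ j | Y \<Rightarrow> matrix \<sigma> $ 1 $ 2)"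

lemma coords_X:
  "Vector_Spaces.linear (*s) (*s) D \<Longrightarrow>
     D (e_basis i) = (\<Sum>j\<in>UNIV. coords (D, \<sigma>) (X i j) *s e_basis j)"
  by (simp add: coords_def e_basis_def matrix_def transpose_def basis_expansion)

lemma coords_Y: "coords (D, sigma b) Y = b"
  by (simp add: coords_def sigma_def)

lemma inj_on_coords: "inj_on coords Der_sigma"
proof (rule inj_onI)
  fix P Q assume "P \<in> Der_sigma" "Q \<in> Der_sigma" and eq: "coords P = coords Q"
  then obtain D b D' b' where P: "P = (D, sigma b)" and Q: "Q = (D', sigma b')"
    and lin: "Vector_Spaces.linear (*s) (*s) D" "Vector_Spaces.linear (*s) (*s) D'"
    by (auto simp: Der_sigma_def twisted_derivation_def)
  have "b = b'" using eq P Q coords_Y by metis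
  moreover have "matrix D = matrix D'"
    unfolding vec_eq_iff
  proof (intro allI)
    fix i j
    show "matrix D $ i $ j = matrix D' $ i $ j"
      using fun_cong[OF eq, of "X j i"] P Q by (simp add: coords_def transpose_def)
  qed
  then have "D = D'" using lin by (metis matrix_works ext)
  ultimately show "P = Q" using P Q by simp
qed

definition p1 :: "coord mpoly set" where
  "p1 = ideal_gen {Var (X 1 3), Var (X 2 2), Var (X 3 1), Var Y,
     Var (X 1 1) + Var (X 3 3),
     Var (X 1 2) + Const 2 * Var (X 2 3),
     Var (X 2 1) + Const (1/2) * Var (X 3 2)}"

definition p2 :: "coord mpoly set" where
  "p2 = ideal_gen {Var (X 1 1), Var (X 1 2), Var (X 1 3), Var (X 2 2), Var (X 2 3), Var (X 3 3),
     Var (X 2 1) + Const (1/2) * Var (X 3 2),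
     Var (X 3 1) - Const (1/2) * Var (X 3 2) * Var Y}"

end

theory Submission
  imports Defs "HOL-Library.Function_Algebras"
begin

text \<open>
  The twisted Leibniz rule for the basis vectors is a list of polynomial equations in the ten
  coordinates.  The pairs of distinct basis vectors give \<open>x\<^sub>1\<^sub>3 = x\<^sub>2\<^sub>2 = 0\<close>, \<open>x\<^sub>3\<^sub>3 = -x\<^sub>1\<^sub>1\<close>,
  \<open>x\<^sub>1\<^sub>2 = -2x\<^sub>2\<^sub>3\<close>, \<open>x\<^sub>2\<^sub>1 = -x\<^sub>3\<^sub>2/2\<close> and \<open>x\<^sub>3\<^sub>1 = x\<^sub>3\<^sub>2 y/2\<close>.  The decisive ones come from the
  diagonal pairs: since \<open>D[x,x] = 0\<close>, the vector \<open>D x\<close> commutes with \<open>\<sigma> x - x\<close>, and for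
  \<open>x = e\<^sub>2, e\<^sub>3\<close> this yields \<open>y x\<^sub>2\<^sub>3 = 0\<close> and \<open>y x\<^sub>3\<^sub>3 = 0\<close>.  Hence either \<open>y = 0\<close>, which leaves the
  equations of \<open>p1\<close> and the ordinary derivations, or \<open>x\<^sub>2\<^sub>3 = x\<^sub>3\<^sub>3 = 0\<close>, which leaves those of \<open>p2\<close>
  (lemma \<open>twisted_derivation_iff\<close>).

  The first zero locus is a linear space of dimension three, the second is the graph of a polynomial
  map over the plane with coordinates \<open>x\<^sub>3\<^sub>2\<close> and \<open>y\<close>.  So both are images of affine spaces under polynomial maps with
  polynomial retractions, hence homeomorphic to affine spaces in the Zariski topology.  Therefore they
  are irreducible, and as neither contains the other they are the components of their union.

  Their dimensions follow once affine \<open>d\<close>-space is known to have Krull dimension \<open>d\<close>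
  (\<open>krull_dim_affine_space\<close>).  Coordinate subspaces form a chain of length \<open>d\<close>.  For the upper bound,
  choose along a chain \<open>Z\<^sub>0 \<subset> \<dots> \<subset> Z\<^sub>n\<close> polynomials \<open>g\<^sub>i\<close> that vanish on \<open>Z\<^sub>i\<close> but not on
  \<open>Z\<^sub>i\<^sub>+\<^sub>1\<close>.  Irreducibility forces the monomials in \<open>g\<^sub>0, \<dots>, g\<^sub>n\<^sub>-\<^sub>1\<close> to be linearly independent
  (\<open>chain_monomials_independent\<close>).  There are \<open>N\<^sup>n\<close> of them with exponents below \<open>N\<close>, but they
  lie in a space of polynomials whose dimension is \<open>O(N\<^sup>d)\<close> (\<open>monomials_dependent\<close>), so
  \<open>n \<le> d\<close>.
\<close>

section \<open>Polynomial functions and Zariski continuity\<close>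

definition polyfun :: "(('x \<Rightarrow> complex) \<Rightarrow> complex) \<Rightarrow> bool" where
  "polyfun f \<longleftrightarrow> (\<exists>p. f = eval_poly p)"

lemma eval_poly_diff: "eval_poly (p - q) a = eval_poly p a - eval_poly q a"
  using eval_poly_add[of "p - q" q a] by simp

lemma polyfun_eval_poly: "polyfun (eval_poly p)"
  by (auto simp: polyfun_def)

lemma polyfun_const: "polyfun (\<lambda>_. c)"
  unfolding polyfun_def by (rule exI[of _ "Const c"]) (simp add: eval_poly_Const fun_eq_iff)

lemma polyfun_coord: "polyfun (\<lambda>a. a v)"
  unfolding polyfun_def by (rule exI[of _ "Var v"]) (simp add: eval_poly_Var fun_eq_iff)

lemma polyfun_add: "polyfun f \<Longrightarrow> polyfun g \<Longrightarrow> polyfun (\<lambda>a. f a + g a)"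
  unfolding polyfun_def by (auto simp flip: eval_poly_add)

lemma polyfun_mult: "polyfun f \<Longrightarrow> polyfun g \<Longrightarrow> polyfun (\<lambda>a. f a * g a)"
  unfolding polyfun_def by (auto simp flip: eval_poly_mult)

lemma polyfun_power: "polyfun f \<Longrightarrow> polyfun (\<lambda>a. f a ^ k)"
  by (induction k) (auto intro: polyfun_const polyfun_mult)

lemma polyfun_sum: "(\<And>i. i \<in> I \<Longrightarrow> polyfun (f i)) \<Longrightarrow> polyfun (\<lambda>a. \<Sum>i\<in>I. f i a)"
  by (induction I rule: infinite_finite_induct) (auto intro: polyfun_const polyfun_add)

lemma polyfun_prod: "(\<And>i. i \<in> I \<Longrightarrow> polyfun (f i)) \<Longrightarrow> polyfun (\<lambda>a. \<Prod>i\<in>I. f i a)"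
  by (induction I rule: infinite_finite_induct) (auto intro: polyfun_const polyfun_mult)

lemma polyfun_uminus: "polyfun f \<Longrightarrow> polyfun (\<lambda>a. - f a)"
  using polyfun_mult[OF polyfun_const[of "-1"]] by simp

lemma polyfun_divide: "polyfun f \<Longrightarrow> polyfun (\<lambda>a. f a / c)"
  using polyfun_mult[OF polyfun_const[of "1 / c"]] by simp

lemmas polyfun_intros =
  polyfun_const polyfun_coord polyfun_add polyfun_mult polyfun_power polyfun_sum polyfun_prod
  polyfun_uminus polyfun_divide

lemma polyfun_compose:
  assumes "polyfun f" and \<phi>: "\<And>v. polyfun (\<lambda>a. \<phi> a v)"
  shows "polyfun (\<lambda>a. f (\<phi> a))"
proof -
  obtain p where f: "f = eval_poly p" using assms(1) by (auto simp: polyfun_def)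
  have "polyfun (\<lambda>a. eval_poly p (\<phi> a))"
  proof (induction p rule: mpoly_induct)
    case (single m c)
    show ?case
      unfolding eval_poly_single eval_monom_def by (intro polyfun_intros \<phi>)
  next
    case (add p q)
    then show ?case by (simp add: eval_poly_add polyfun_add)
  qed
  then show ?thesis by (simp add: f)
qed

lemma closedin_zariski_zeros: "polyfun f \<Longrightarrow> closedin zariski {a. f a = 0}"
proof -
  assume "polyfun f"
  then obtain p where "f = eval_poly p" by (auto simp: polyfun_def)
  then have "{a. f a = 0} = zero_locus {p}" by (simp add: zero_locus_def)
  then show ?thesis unfolding closedin_zariski by blast
qed

text \<open>
  A closed set is an intersection of zero sets of polynomials, and the preimage of each of them
  is the zero set of a composite, which is again polynomial.
\<close>

lemma continuous_map_zariski:
  fixes \<phi> :: "('n \<Rightarrow> complex) \<Rightarrow> 'x \<Rightarrow> complex"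
  assumes "\<And>v. polyfun (\<lambda>a. \<phi> a v)"
  shows "continuous_map zariski zariski \<phi>"
  unfolding continuous_map_closedin
proof (intro conjI allI impI)
  fix C :: "('x \<Rightarrow> complex) set" assume "closedin zariski C"
  then obtain S where C: "C = zero_locus S" by (auto simp: closedin_zariski)
  have "{a. \<phi> a \<in> C} = (\<Inter>p\<in>S. {a. eval_poly p (\<phi> a) = 0})"
    by (auto simp: C zero_locus_def)
  also have "closedin zariski \<dots>"
  (* An empty family has to be treated apart: its intersection is the whole space. *)
  proof (cases "S = {}")
    case True
    then show ?thesis using closedin_topspace[of zariski] by (simp add: topspace_zariski)
  next
    case False
    then show ?thesis
      by (intro closedin_Inter)
        (auto intro!: closedin_zariski_zeros polyfun_compose[OF polyfun_eval_poly] assms)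
  qed
  finally show "closedin zariski {a \<in> topspace zariski. \<phi> a \<in> C}"
    by (simp add: topspace_zariski)
qed (simp add: topspace_zariski)

text \<open>
  Restriction to the line through two points turns questions about polynomials in arbitrarily many
  indeterminates into questions about univariate polynomials.
\<close>

lemma polyfun_on_line:
  assumes "polyfun f"
  obtains q :: "complex poly" where "\<And>t. f (\<lambda>v. a v + t * (b v - a v)) = poly q t"
proof -
  obtain p where f: "f = eval_poly p" using assms by (auto simp: polyfun_def)
  have "\<exists>q. \<forall>t. eval_poly p (\<lambda>v. a v + t * (b v - a v)) = poly q t"
  proof (induction p rule: mpoly_induct)
    case (single m c)
    have "\<forall>t. eval_poly (Poly_Mapping.single m c) (\<lambda>v. a v + t * (b v - a v)) =
        poly ([:c:] * (\<Prod>v\<in>Poly_Mapping.keys m. [:a v, b v - a v:] ^ Poly_Mapping.lookup m v)) t"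
      by (simp add: eval_poly_single eval_monom_def poly_prod)
    then show ?case by blast
  next
    case (add p q)
    then obtain q1 q2 where
      "\<forall>t. eval_poly p (\<lambda>v. a v + t * (b v - a v)) = poly q1 t"
      "\<forall>t. eval_poly q (\<lambda>v. a v + t * (b v - a v)) = poly q2 t"
      by blast
    then have "\<forall>t. eval_poly (p + q) (\<lambda>v. a v + t * (b v - a v)) = poly (q1 + q2) t"
      by (simp add: eval_poly_add)
    then show ?case by blast
  qed
  then show thesis using that f by blast
qed

section \<open>Irreducible sets\<close>

text \<open>
  Irreducibility phrased with closed sets of the ambient space, which avoids subspace topologies in
  everything that follows.
\<close>

lemma irreducible_subset_iff:
  "irreducible_subset T Z \<longleftrightarrow> Z \<subseteq> topspace T \<and> Z \<noteq> {} \<and>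
     (\<forall>C C'. closedin T C \<and> closedin T C' \<and> Z \<subseteq> C \<union> C' \<longrightarrow> Z \<subseteq> C \<or> Z \<subseteq> C')"
proof (cases "Z \<subseteq> topspace T")
  case True
  have split: "(C \<inter> Z) \<union> (C' \<inter> Z) = Z \<longleftrightarrow> Z \<subseteq> C \<union> C'" "C \<inter> Z = Z \<longleftrightarrow> Z \<subseteq> C" for C C'
    by blast+
  from True have top: "topspace (subtopology T Z) = Z" by (auto simp: topspace_subtopology)
  have "(\<forall>C C'. closedin (subtopology T Z) C \<and> closedin (subtopology T Z) C' \<and> C \<union> C' = Z
            \<longrightarrow> C = Z \<or> C' = Z)
    \<longleftrightarrow> (\<forall>C C'. closedin T C \<and> closedin T C' \<and> (C \<inter> Z) \<union> (C' \<inter> Z) = Z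
            \<longrightarrow> C \<inter> Z = Z \<or> C' \<inter> Z = Z)"
    unfolding closedin_subtopology by blast
  also have "\<dots> \<longleftrightarrow> (\<forall>C C'. closedin T C \<and> closedin T C' \<and> Z \<subseteq> C \<union> C' \<longrightarrow> Z \<subseteq> C \<or> Z \<subseteq> C')"
    by (simp only: split)
  finally show ?thesis
    using True by (simp only: irreducible_subset_def irreducible_space_def top)
qed (simp add: irreducible_subset_def)

lemma irreducible_subset_subtopology:
  assumes "S \<subseteq> topspace T"
  shows "irreducible_subset (subtopology T S) Z \<longleftrightarrow> Z \<subseteq> S \<and> irreducible_subset T Z"
  using assms
  by (auto simp: irreducible_subset_def subtopology_subtopology topspace_subtopology_subset
      Int_absorb1)

lemma irreducible_subset_continuous_image:
  assumes "continuous_map T T' f" "irreducible_subset T Z"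
  shows "irreducible_subset T' (f ` Z)"
  unfolding irreducible_subset_iff
proof (intro conjI allI impI)
  have Z: "Z \<subseteq> topspace T" "Z \<noteq> {}"
    and irr: "\<And>C C'. closedin T C \<Longrightarrow> closedin T C' \<Longrightarrow> Z \<subseteq> C \<union> C' \<Longrightarrow> Z \<subseteq> C \<or> Z \<subseteq> C'"
    using assms(2) unfolding irreducible_subset_iff by blast+
  show "f ` Z \<subseteq> topspace T'" "f ` Z \<noteq> {}"
    using Z assms(1) by (auto simp: continuous_map_def)
  fix C C' assume C: "closedin T' C \<and> closedin T' C' \<and> f ` Z \<subseteq> C \<union> C'"
  have "closedin T {x \<in> topspace T. f x \<in> C}" "closedin T {x \<in> topspace T. f x \<in> C'}"
    using assms(1) C by (auto simp: continuous_map_closedin)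
  from irr[OF this] C Z(1) show "f ` Z \<subseteq> C \<or> f ` Z \<subseteq> C'" by blast
qed

text \<open>
  If two closed sets missed a point each, the polynomials witnessing this, restricted to the line
  through the two points, would be nonzero univariate polynomials.  Their product vanishes
  everywhere if the closed sets cover the space, which is impossible over an infinite field.
\<close>

lemma irreducible_affine_space: "irreducible_subset zariski (UNIV :: ('x \<Rightarrow> complex) set)"
  unfolding irreducible_subset_iff topspace_zariski
proof (intro conjI allI impI)
  fix C C' :: "('x \<Rightarrow> complex) set"
  assume "closedin zariski C \<and> closedin zariski C' \<and> UNIV \<subseteq> C \<union> C'"
  then obtain S S' where C: "C = zero_locus S" "C' = zero_locus S'" and cover: "C \<union> C' = UNIV"
    unfolding closedin_zariski by blast
  show "UNIV \<subseteq> C \<or> UNIV \<subseteq> C'"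
  proof (rule ccontr)
    assume "\<not> ?thesis"
    then obtain a b where "a \<notin> C" "b \<notin> C'" by blast
    then obtain p p' where p: "p \<in> S" "eval_poly p a \<noteq> 0" and p': "p' \<in> S'" "eval_poly p' b \<noteq> 0"
      by (auto simp: C zero_locus_def)
    obtain q where q: "\<And>t. eval_poly p (\<lambda>v. a v + t * (b v - a v)) = poly q t"
      using polyfun_on_line[OF polyfun_eval_poly] by blast
    obtain q' where q': "\<And>t. eval_poly p' (\<lambda>v. a v + t * (b v - a v)) = poly q' t"
      using polyfun_on_line[OF polyfun_eval_poly] by blast
    have "poly (q * q') t = 0" for t
    proof -
      have "(\<lambda>v. a v + t * (b v - a v)) \<in> C \<union> C'" using cover by blast
      then show ?thesis using p(1) p'(1) by (auto simp: C zero_locus_def simp flip: q q')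
    qed
    then have "q * q' = 0" using poly_all_0_iff_0 by blast
    moreover have "poly q 0 \<noteq> 0" "poly q' 1 \<noteq> 0" using p(2) p'(2) q[of 0] q'[of 1] by auto
    ultimately show False by auto
  qed
qed auto

text \<open>
  An irreducible subset of a union of two closed sets lies in one of them; so no irreducible set
  properly contains \<open>V\<close> or \<open>W\<close>, and every maximal one is \<open>V\<close> or \<open>W\<close>.
\<close>

lemma irreducible_components_Un:
  assumes irr: "irreducible_subset T V" "irreducible_subset T W"
    and cl: "closedin T V" "closedin T W"
    and ne: "\<not> V \<subseteq> W" "\<not> W \<subseteq> V"
  shows "irreducible_components (subtopology T (V \<union> W)) = {V, W}"
proof -
  have sub: "irreducible_subset (subtopology T (V \<union> W)) Z
      \<longleftrightarrow> Z \<subseteq> V \<union> W \<and> irreducible_subset T Z" for Z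
    by (rule irreducible_subset_subtopology) (use cl closedin_subset in blast)
  have *: "Z \<subseteq> V \<or> Z \<subseteq> W" if "Z \<subseteq> V \<union> W" "irreducible_subset T Z" for Z
  proof -
    from that(2) have "\<And>C C'. closedin T C \<Longrightarrow> closedin T C' \<Longrightarrow> Z \<subseteq> C \<union> C' \<Longrightarrow> Z \<subseteq> C \<or> Z \<subseteq> C'"
      by (simp add: irreducible_subset_iff)
    from this[OF cl that(1)] show ?thesis .
  qed
  have comp: "Z \<in> irreducible_components (subtopology T (V \<union> W)) \<longleftrightarrow>
      Z \<subseteq> V \<union> W \<and> irreducible_subset T Z \<and>
      (\<forall>Z'. Z' \<subseteq> V \<union> W \<and> irreducible_subset T Z' \<and> Z \<subseteq> Z' \<longrightarrow> Z' = Z)" for Z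
    by (simp add: irreducible_components_def sub)
  have "V \<in> irreducible_components (subtopology T (V \<union> W))"
    unfolding comp
  proof (intro conjI allI impI irr)
    fix Z' assume "Z' \<subseteq> V \<union> W \<and> irreducible_subset T Z' \<and> V \<subseteq> Z'"
    then show "Z' = V" using *[of Z'] ne(1) by auto
  qed simp
  moreover have "W \<in> irreducible_components (subtopology T (V \<union> W))"
    unfolding comp
  proof (intro conjI allI impI irr)
    fix Z' assume "Z' \<subseteq> V \<union> W \<and> irreducible_subset T Z' \<and> W \<subseteq> Z'"
    then show "Z' = W" using *[of Z'] ne(2) by auto
  qed simp
  moreover have "Z \<in> {V, W}" if "Z \<in> irreducible_components (subtopology T (V \<union> W))" for Z
  proof -
    have Z: "Z \<subseteq> V \<union> W" "irreducible_subset T Z"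
      and max: "\<And>Z'. Z' \<subseteq> V \<union> W \<Longrightarrow> irreducible_subset T Z' \<Longrightarrow> Z \<subseteq> Z' \<Longrightarrow> Z' = Z"
      using that unfolding comp by blast+
    from *[OF Z] show ?thesis using max[of V] max[of W] irr by auto
  qed
  ultimately show ?thesis by blast
qed

section \<open>Krull dimension under homeomorphisms\<close>

text \<open>
  A homeomorphism carries chains of irreducible closed sets to such chains of the same length.
\<close>

lemma krull_dim_le_if_homeomorphic_map:
  assumes "homeomorphic_map S T f"
  shows "krull_dim S \<le> krull_dim T"
  unfolding krull_dim_def
proof (rule Sup_subset_mono, rule subsetI)
  fix d assume "d \<in> {enat n |n. \<exists>Z. (\<forall>i\<le>n. closedin S (Z i) \<and> irreducible_subset S (Z i)) \<and>
      (\<forall>i<n. Z i \<subset> Z (Suc i))}"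
  then obtain n Z where d: "d = enat n"
    and Z: "\<And>i. i \<le> n \<Longrightarrow> closedin S (Z i) \<and> irreducible_subset S (Z i)"
    and less: "\<And>i. i < n \<Longrightarrow> Z i \<subset> Z (Suc i)"
    by blast
  have inj: "inj_on f (topspace S)" and cont: "continuous_map S T f"
    using assms by (auto simp: homeomorphic_eq_everything_map)
  have sub: "Z i \<subseteq> topspace S" if "i \<le> n" for i using Z[OF that] closedin_subset by blast
  have "closedin T (f ` Z i) \<and> irreducible_subset T (f ` Z i)" if "i \<le> n" for i
    using Z[OF that] homeomorphic_map_closedness_eq[OF assms]
      irreducible_subset_continuous_image[OF cont] by blast
  moreover have "f ` Z i \<subset> f ` Z (Suc i)" if "i < n" for i
    using that by (intro image_strict_mono[OF inj_on_subset[OF inj sub[of "Suc i"]] less]) auto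
  ultimately show "d \<in> {enat n |n. \<exists>Z. (\<forall>i\<le>n. closedin T (Z i) \<and> irreducible_subset T (Z i)) \<and>
      (\<forall>i<n. Z i \<subset> Z (Suc i))}"
    unfolding mem_Collect_eq d
    by (intro exI[of _ n] exI[of _ "\<lambda>i. f ` Z i"] conjI allI impI refl) auto
qed

lemma krull_dim_homeomorphic:
  assumes "S homeomorphic_space T"
  shows "krull_dim S = krull_dim T"
  using assms homeomorphic_space_sym[of S T]
  by (auto simp: homeomorphic_space intro!: antisym dest: krull_dim_le_if_homeomorphic_map)

text \<open>
  Used to transport the Krull dimension from affine space to parametrized varieties.
\<close>

lemma homeomorphic_range_if_polynomial_retraction:
  fixes \<phi> :: "('n \<Rightarrow> complex) \<Rightarrow> 'x \<Rightarrow> complex"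
  assumes "\<And>v. polyfun (\<lambda>a. \<phi> a v)" "\<And>v. polyfun (\<lambda>a. \<psi> a v)" "\<And>a. \<psi> (\<phi> a) = a"
  shows "(zariski :: ('n \<Rightarrow> complex) topology) homeomorphic_space subtopology zariski (range \<phi>)"
proof -
  have "homeomorphic_maps zariski (subtopology zariski (range \<phi>)) \<phi> \<psi>"
    unfolding homeomorphic_maps_def
    using assms
    by (auto simp: continuous_map_in_subtopology topspace_zariski continuous_map_zariski
        intro!: continuous_map_from_subtopology)
  then show ?thesis unfolding homeomorphic_space_def by blast
qed

section \<open>The Krull dimension of affine space\<close>

text \<open>
  Tuples are extensional functions, so that a tuple of length \<open>Suc n\<close> is in a unique way a tuple of
  length \<open>n\<close> updated at \<open>n\<close>, and distinct elements stand for distinct monomials.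
\<close>

definition exponent_tuples :: "nat \<Rightarrow> nat \<Rightarrow> (nat \<Rightarrow> nat) set" where
  "exponent_tuples n N = PiE {..<n} (\<lambda>_. {..<N})"

text \<open>
  Suppose \<open>\<Sum>\<^sub>j h\<^sub>j g\<^sup>j = 0\<close> on an irreducible \<open>W\<close> where \<open>g\<close> is not identically zero.  If the
  coefficients below \<open>j\<close> vanish, a factor \<open>g\<^sup>j\<close> splits off; it can be cancelled because \<open>W\<close> is
  irreducible.  On \<open>Z\<close>, where \<open>g\<close> vanishes, the remaining relation says \<open>h\<^sub>j = 0\<close>.  The hypothesis
  \<open>ext\<close>, that a coefficient vanishing on the smaller set \<open>Z\<close> vanishes on all of \<open>W\<close>, holds in the
  application because the coefficients are combinations of monomials that are already independent
  on \<open>Z\<close>.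
\<close>

lemma relation_coefficients_vanish:
  assumes irr: "irreducible_subset zariski W"
    and h: "\<And>j. polyfun (h j)" and g: "polyfun g"
    and w: "w \<in> W" "g w \<noteq> 0"
    and Z: "Z \<subseteq> W" "\<And>z. z \<in> Z \<Longrightarrow> g z = 0"
    and zero: "\<And>a. a \<in> W \<Longrightarrow> (\<Sum>j<N. h j a * g a ^ j) = 0"
    and ext: "\<And>j. (\<And>z. z \<in> Z \<Longrightarrow> h j z = 0) \<Longrightarrow> (\<And>a. a \<in> W \<Longrightarrow> h j a = 0)"
    and "j < N" "z \<in> W"
  shows "h j z = 0"
  using \<open>j < N\<close> \<open>z \<in> W\<close>
proof (induction j arbitrary: z rule: less_induct)
  case (less j)
  (* The cofactor of g^j in the relation. *)
  define r where "r a = (\<Sum>i<N - j. h (j + i) a * g a ^ i)" for a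
  have r: "polyfun r"
    unfolding r_def[abs_def] by (intro polyfun_intros h g)
  have factor: "(\<Sum>i<N. h i a * g a ^ i) = g a ^ j * r a" if "a \<in> W" for a
  proof -
    have "(\<Sum>i<N. h i a * g a ^ i) = (\<Sum>i<j. h i a * g a ^ i) + (\<Sum>i=j..<N. h i a * g a ^ i)"
      using sum.atLeastLessThan_concat[of 0 j N "\<lambda>i. h i a * g a ^ i"] less.prems(1)
      by (simp add: atLeast0LessThan)
    also have "(\<Sum>i<j. h i a * g a ^ i) = 0"
      using less.IH less.prems(1) that by (intro sum.neutral) auto
    also have "(\<Sum>i=j..<N. h i a * g a ^ i) = (\<Sum>i<N - j. h (j + i) a * g a ^ (j + i))"
      using sum.shift_bounds_nat_ivl[of "\<lambda>i. h i a * g a ^ i" 0 j "N - j"] less.prems(1)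
      by (simp add: atLeast0LessThan add.commute)
    also have "\<dots> = g a ^ j * r a"
      by (simp add: r_def sum_distrib_left power_add mult_ac)
    finally show ?thesis by simp
  qed
  have "W \<subseteq> {a. g a = 0} \<union> {a. r a = 0}"
    using factor zero by fastforce
  with irr have "W \<subseteq> {a. g a = 0} \<or> W \<subseteq> {a. r a = 0}"
    using closedin_zariski_zeros[OF g] closedin_zariski_zeros[OF r]
    by (simp add: irreducible_subset_iff)
  with w have rW: "r a = 0" if "a \<in> W" for a using that by blast
  have "h j z = 0" if "z \<in> Z" for z
  proof -
    have "r z = (\<Sum>i\<in>{0}. h (j + i) z * g z ^ i)"
      unfolding r_def using less.prems(1) Z(2)[OF that]
      by (intro sum.mono_neutral_right) auto
    then show ?thesis using rW[of z] Z(1) that by auto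
  qed
  then show ?case using ext less.prems(2) by blast
qed

lemma exponent_tuples_0: "exponent_tuples 0 N = {\<lambda>_. undefined}"
  by (simp add: exponent_tuples_def)

lemma sum_exponent_tuples_Suc:
  "(\<Sum>\<alpha>\<in>exponent_tuples (Suc n) N. F \<alpha>) = (\<Sum>j<N. \<Sum>\<alpha>\<in>exponent_tuples n N. F (\<alpha>(n := j)))"
proof -
  let ?f = "\<lambda>(j, \<alpha>). \<alpha>(n := j)"
  have inj: "inj_on ?f ({..<N} \<times> exponent_tuples n N)"
    unfolding exponent_tuples_def using inj_combinator[of n "{..<n}" "\<lambda>_. {..<N}"] by simp
  have img: "exponent_tuples (Suc n) N = ?f ` ({..<N} \<times> exponent_tuples n N)"
    by (simp add: exponent_tuples_def lessThan_Suc PiE_insert_eq)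
  show ?thesis
    unfolding img sum.reindex[OF inj] by (simp add: sum.cartesian_product case_prod_beta)
qed

text \<open>
  Induction along the chain: a linear relation between the monomials on the largest set is a relation
  between powers of the last function, whose coefficients are combinations of monomials in the
  earlier functions.  These coefficients vanish on the previous member of the chain, where the
  earlier monomials are independent by induction.
\<close>

lemma chain_monomials_independent:
  assumes irr: "\<And>i. i \<le> n \<Longrightarrow> irreducible_subset zariski (Z i)"
    and sub: "\<And>i. i < n \<Longrightarrow> Z i \<subseteq> Z (Suc i)"
    and g: "\<And>i. i < n \<Longrightarrow> polyfun (g i)"
    and vanish: "\<And>i z. i < n \<Longrightarrow> z \<in> Z i \<Longrightarrow> g i z = 0"
    and nonzero: "\<And>i. i < n \<Longrightarrow> \<exists>z\<in>Z (Suc i). g i z \<noteq> 0"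
    and zero: "\<And>a. a \<in> Z n \<Longrightarrow> (\<Sum>\<alpha>\<in>exponent_tuples n N. c \<alpha> * (\<Prod>i<n. g i a ^ \<alpha> i)) = 0"
    and "\<alpha> \<in> exponent_tuples n N"
  shows "c \<alpha> = 0"
  using assms
proof (induction n arbitrary: c \<alpha>)
  case 0
  then have "Z 0 \<noteq> {}" by (simp add: irreducible_subset_iff)
  with "0.prems" show ?case by (auto simp: exponent_tuples_0)
next
  case (Suc n)
  define h where "h j a = (\<Sum>\<alpha>\<in>exponent_tuples n N. c (\<alpha>(n := j)) * (\<Prod>i<n. g i a ^ \<alpha> i))" for j a
  have coeff: "c (\<alpha>(n := j)) = 0"
    if "\<And>z. z \<in> Z n \<Longrightarrow> h j z = 0" "\<alpha> \<in> exponent_tuples n N" for j \<alpha>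
  proof (rule Suc.IH[of "\<lambda>\<alpha>. c (\<alpha>(n := j))"])
    show "Z i \<subseteq> Z (Suc i)" if "i < n" for i using Suc.prems(2) that by simp
    show "g i z = 0" if "i < n" "z \<in> Z i" for i z using Suc.prems(4) that by simp
    show "(\<Sum>\<alpha>\<in>exponent_tuples n N. c (\<alpha>(n := j)) * (\<Prod>i<n. g i a ^ \<alpha> i)) = 0" if "a \<in> Z n" for a
      using \<open>\<And>z. z \<in> Z n \<Longrightarrow> h j z = 0\<close>[OF that] by (simp only: h_def)
  qed (use Suc.prems(1,3,5) that(2) in simp_all)
  obtain w where w: "w \<in> Z (Suc n)" "g n w \<noteq> 0" using Suc.prems(5)[of n] by auto
  obtain j \<beta> where \<alpha>: "j < N" "\<beta> \<in> exponent_tuples n N" "\<alpha> = \<beta>(n := j)"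
    using Suc.prems(7) by (auto simp: exponent_tuples_def lessThan_Suc PiE_insert_eq)
  have "h j z = 0" if "z \<in> Z n" for z
  proof (rule relation_coefficients_vanish[where h=h and g="g n" and W="Z (Suc n)" and Z="Z n"])
    show "polyfun (h j)" for j
      unfolding h_def[abs_def] by (intro polyfun_intros Suc.prems(3)) auto
    show "(\<Sum>j<N. h j a * g n a ^ j) = 0" if "a \<in> Z (Suc n)" for a
    proof -
      have "(\<Sum>j<N. h j a * g n a ^ j) = (\<Sum>j<N. \<Sum>\<alpha>\<in>exponent_tuples n N.
          c (\<alpha>(n := j)) * (\<Prod>i<Suc n. g i a ^ (\<alpha>(n := j)) i))"
        by (simp add: h_def sum_distrib_right mult.assoc)
      then show ?thesis using Suc.prems(6)[OF that] by (simp only: sum_exponent_tuples_Suc)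
    qed
    show "h i a = 0" if "\<And>z. z \<in> Z n \<Longrightarrow> h i z = 0" for i a
      unfolding h_def by (rule sum.neutral) (use coeff[OF that] in simp)
  qed (use Suc.prems(1)[of "Suc n"] Suc.prems(2,3)[of n] Suc.prems(4)[of n] w \<alpha>(1) that in auto)
  from coeff[OF this \<alpha>(2)] show ?case by (simp only: \<alpha>(3))
qed

text \<open>
  Bounding every exponent separately, rather than the total degree, makes counting immediate: the
  exponent vectors form a cube.
\<close>

definition bounded_exponents :: "nat \<Rightarrow> ('n \<Rightarrow>\<^sub>0 nat) set" where
  "bounded_exponents M = {m. \<forall>v. Poly_Mapping.lookup m v \<le> M}"

lemma card_bounded_exponents:
  "finite (bounded_exponents M :: ('n::finite \<Rightarrow>\<^sub>0 nat) set) \<and>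
   card (bounded_exponents M :: ('n \<Rightarrow>\<^sub>0 nat) set) \<le> (M + 1) ^ CARD('n)"
proof -
  let ?E = "bounded_exponents M :: ('n \<Rightarrow>\<^sub>0 nat) set"
  have inj: "inj_on Poly_Mapping.lookup ?E" by (rule inj_onI) (rule poly_mapping_eqI, simp)
  have sub: "Poly_Mapping.lookup ` ?E \<subseteq> PiE UNIV (\<lambda>_. {..M})"
    by (auto simp: bounded_exponents_def)
  have fin: "finite (PiE (UNIV :: 'n set) (\<lambda>_. {..M}))" by (intro finite_PiE) auto
  have "finite (Poly_Mapping.lookup ` ?E)" using finite_subset[OF sub fin] .
  then have "finite ?E" using inj finite_image_iff by blast
  moreover have "card ?E \<le> card (PiE (UNIV :: 'n set) (\<lambda>_. {..M}))"
    by (rule card_inj_on_le[OF inj sub fin])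
  ultimately show ?thesis by (simp add: card_PiE)
qed

interpretation fun_space: vector_space "\<lambda>(c::complex) (f :: 'a \<Rightarrow> complex) x. c * f x"
  by unfold_locales (auto simp: fun_eq_iff algebra_simps)

definition degrees_le :: "nat \<Rightarrow> (('n \<Rightarrow> complex) \<Rightarrow> complex) set" where
  "degrees_le M = fun_space.span (eval_monom ` bounded_exponents M)"

text \<open>
  Both spans are spanned by monomials, and the exponents of a product of monomials add; bilinearity
  is handled by an induction over each span.
\<close>

lemma degrees_le_mult:
  assumes "f \<in> degrees_le M" "g \<in> degrees_le M'"
  shows "(\<lambda>a. f a * g a) \<in> degrees_le (M + M')"
  using assms(1) unfolding degrees_le_def
proof (induction rule: fun_space.span_induct_alt)
  case base
  have "(\<lambda>a. (0 :: _ \<Rightarrow> complex) a * g a) = 0" by auto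
  then show ?case using fun_space.span_zero by metis
next
  case (step c x y)
  have "(\<lambda>a. x a * g a) \<in> fun_space.span (eval_monom ` bounded_exponents (M + M'))"
    using assms(2) unfolding degrees_le_def
  proof (induction rule: fun_space.span_induct_alt)
    case base
    have "(\<lambda>a. x a * (0 :: _ \<Rightarrow> complex) a) = 0" by auto
    then show ?case using fun_space.span_zero by metis
  next
    case (step d u w)
    obtain m m' where m: "x = eval_monom m" "m \<in> bounded_exponents M"
      "u = eval_monom m'" "m' \<in> bounded_exponents M'"
      using step \<open>x \<in> _\<close> by blast
    have "m + m' \<in> bounded_exponents (M + M')"
      using m by (auto simp: bounded_exponents_def lookup_add intro: add_mono)
    moreover have "(\<lambda>a. x a * u a) = eval_monom (m + m')"
      by (simp add: m eval_monom_add fun_eq_iff)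
    ultimately have "(\<lambda>a. x a * u a) \<in> fun_space.span (eval_monom ` bounded_exponents (M + M'))"
      by (auto intro: fun_space.span_base)
    from fun_space.span_add[OF fun_space.span_scale[OF this, of d] step(2)]
    show ?case by (simp add: plus_fun_def algebra_simps)
  qed
  from fun_space.span_add[OF fun_space.span_scale[OF this, of c] step(2)]
  show ?case by (simp add: plus_fun_def algebra_simps)
qed

lemma degrees_le_mono: "M \<le> M' \<Longrightarrow> degrees_le M \<subseteq> degrees_le M'"
  unfolding degrees_le_def
  by (intro fun_space.span_mono image_mono) (auto simp: bounded_exponents_def intro: order_trans)

lemma degrees_le_one: "(\<lambda>_ :: 'n \<Rightarrow> complex. 1) \<in> degrees_le M"
proof -
  have "eval_monom 0 = (\<lambda>_ :: 'n \<Rightarrow> complex. 1)" by (simp add: eval_monom_def fun_eq_iff)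
  moreover have "(eval_monom 0 :: ('n \<Rightarrow> complex) \<Rightarrow> complex) \<in> degrees_le M"
    unfolding degrees_le_def by (intro fun_space.span_base imageI) (simp add: bounded_exponents_def)
  ultimately show ?thesis by simp
qed

lemma degrees_le_power: "f \<in> degrees_le M \<Longrightarrow> (\<lambda>a. f a ^ k) \<in> degrees_le (k * M)"
proof (induction k)
  case 0
  then show ?case by (simp add: degrees_le_one)
next
  case (Suc k)
  then show ?case using degrees_le_mult[of f M "\<lambda>a. f a ^ k" "k * M"] by simp
qed

lemma degrees_le_prod:
  assumes "\<And>i. i < n \<Longrightarrow> f i \<in> degrees_le M"
  shows "(\<lambda>a. \<Prod>i<n. f i a) \<in> degrees_le (n * M)"
  using assms
proof (induction n)
  case 0
  then show ?case by (simp add: degrees_le_one)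
next
  case (Suc n)
  then have "(\<lambda>a. (\<Prod>i<n. f i a) * f n a) \<in> degrees_le (n * M + M)"
    by (intro degrees_le_mult) auto
  then show ?case by (simp add: add.commute)
qed

lemma polyfun_degrees_le:
  fixes f :: "('n::finite \<Rightarrow> complex) \<Rightarrow> complex"
  assumes "polyfun f"
  obtains M where "f \<in> degrees_le M"
proof -
  obtain p where f: "f = eval_poly p" using assms by (auto simp: polyfun_def)
  have "\<exists>M. eval_poly p \<in> degrees_le M"
  proof (induction p rule: mpoly_induct)
    case (single m c)
    let ?M = "\<Sum>v\<in>UNIV. Poly_Mapping.lookup m v"
    have "m \<in> bounded_exponents ?M" by (auto simp: bounded_exponents_def intro: member_le_sum)
    then have "(\<lambda>a. c * eval_monom m a) \<in> degrees_le ?M"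
      unfolding degrees_le_def by (intro fun_space.span_scale fun_space.span_base imageI)
    moreover have "eval_poly (Poly_Mapping.single m c) = (\<lambda>a. c * eval_monom m a)"
      by (simp add: eval_poly_single fun_eq_iff)
    ultimately show ?case by (simp only:) blast
  next
    case (add p q)
    then obtain M M' where M: "eval_poly p \<in> degrees_le M" "eval_poly q \<in> degrees_le M'" by blast
    have "eval_poly p + eval_poly q \<in> degrees_le (max M M')"
      using M degrees_le_mono[of M "max M M'"] degrees_le_mono[of M' "max M M'"]
      unfolding degrees_le_def by (intro fun_space.span_add) auto
    moreover have "eval_poly (p + q) = eval_poly p + eval_poly q"
      by (simp add: eval_poly_add fun_eq_iff)
    ultimately show ?case by (simp only:) blast
  qed
  then show thesis using that f by blast
qed

text \<open>
  A counting argument.  If each \<open>g i\<close> has degree at most \<open>D\<close> in every indeterminate, a monomial in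
  \<open>n\<close> of them with exponents below \<open>N\<close> has degree at most \<open>n N D\<close> in every indeterminate.  The space of such
  polynomials has dimension at most \<open>(n N D + 1)\<^sup>d\<close>, which for large \<open>N\<close> is less than the number
  \<open>N\<^sup>n\<close> of monomials, as \<open>n > d\<close>.
\<close>

lemma monomials_dependent:
  fixes g :: "nat \<Rightarrow> ('n::finite \<Rightarrow> complex) \<Rightarrow> complex"
  assumes g: "\<And>i. i < n \<Longrightarrow> polyfun (g i)" and n: "CARD('n) < n"
  obtains N c \<alpha> where "\<alpha> \<in> exponent_tuples n N" "c \<alpha> \<noteq> 0"
    "\<And>a. (\<Sum>\<alpha>\<in>exponent_tuples n N. c \<alpha> * (\<Prod>i<n. g i a ^ \<alpha> i)) = 0"
proof -
  let ?d = "CARD('n)"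
  have "\<forall>i\<in>{..<n}. \<exists>M. g i \<in> degrees_le M"
    using polyfun_degrees_le[OF g] by (metis lessThan_iff)
  then obtain M where "\<forall>i\<in>{..<n}. g i \<in> degrees_le (M i)" by (rule bchoice[THEN exE])
  then have M: "g i \<in> degrees_le (Suc (\<Sum>i<n. M i))" if "i < n" for i
    using that degrees_le_mono[of "M i" "Suc (\<Sum>i<n. M i)"] member_le_sum[of i "{..<n}" M] by fastforce
  define D where "D = Suc (\<Sum>i<n. M i)"
  (* The bound n * N * D + 1 is at most K * N, and N is chosen such that K ^ d < N. *)
  define K where "K = 2 * n * D"
  define N where "N = Suc (K ^ ?d)"
  define G where "G \<alpha> = (\<lambda>a. \<Prod>i<n. g i a ^ \<alpha> i)" for \<alpha> :: "nat \<Rightarrow> nat"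
  define B where "B = (eval_monom ` bounded_exponents (n * (N * D)) :: (('n \<Rightarrow> complex) \<Rightarrow> complex) set)"
  have fin: "finite (exponent_tuples n N)" by (simp add: exponent_tuples_def finite_PiE)
  have G: "G ` exponent_tuples n N \<subseteq> fun_space.span B"
  proof
    fix f assume "f \<in> G ` exponent_tuples n N"
    then obtain \<alpha> where \<alpha>: "\<alpha> \<in> exponent_tuples n N" "f = G \<alpha>" by blast
    have "(\<lambda>a. g i a ^ \<alpha> i) \<in> degrees_le (N * D)" if "i < n" for i
    proof -
      have "\<alpha> i \<le> N" using \<alpha>(1) that by (auto simp: exponent_tuples_def PiE_iff intro: less_imp_le)
      then have "degrees_le (\<alpha> i * D) \<subseteq> degrees_le (N * D)" by (intro degrees_le_mono) simp
      then show ?thesis using degrees_le_power[OF M[OF that]] by (auto simp: D_def)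
    qed
    from degrees_le_prod[OF this] show "f \<in> fun_space.span B"
      by (simp add: \<alpha>(2) G_def B_def degrees_le_def)
  qed
  have finB: "finite B" using card_bounded_exponents by (auto simp: B_def)
  have "card B \<le> card (bounded_exponents (n * (N * D)) :: ('n \<Rightarrow>\<^sub>0 nat) set)"
    unfolding B_def using card_bounded_exponents by (intro card_image_le) blast
  also have "\<dots> \<le> (n * (N * D) + 1) ^ ?d" using card_bounded_exponents by blast
  also have "\<dots> \<le> (K * N) ^ ?d"
  proof (rule power_mono)
    have "0 < n * (N * D)" using n by (simp add: N_def D_def)
    moreover have "K * N = 2 * (n * (N * D))" by (simp add: K_def)
    ultimately show "n * (N * D) + 1 \<le> K * N" by linarith
  qed simp
  also have "\<dots> = K ^ ?d * N ^ ?d" by (simp add: power_mult_distrib)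
  also have "\<dots> < N * N ^ ?d" by (simp add: N_def)
  also have "\<dots> \<le> N ^ n" using n power_increasing[of "Suc ?d" n N] by (simp add: N_def)
  also have "N ^ n = card (exponent_tuples n N)" by (simp add: exponent_tuples_def card_PiE)
  finally have less: "card B < card (exponent_tuples n N)" .
  (* Linear dependence of a set of functions misses coincidences within the family, which give
     a relation of their own. *)
  show thesis
  proof (cases "inj_on G (exponent_tuples n N)")
    case False
    then obtain \<alpha> \<beta> where ab: "\<alpha> \<in> exponent_tuples n N" "\<beta> \<in> exponent_tuples n N" "\<alpha> \<noteq> \<beta>" "G \<alpha> = G \<beta>"
      by (auto simp: inj_on_def)
    define c where "c \<gamma> = (if \<gamma> = \<alpha> then 1 else 0) - (if \<gamma> = \<beta> then 1 else (0::complex))" for \<gamma>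
    have "(\<Sum>\<gamma>\<in>exponent_tuples n N. c \<gamma> * G \<gamma> a) = G \<alpha> a - G \<beta> a" for a
      using ab fin by (simp add: c_def left_diff_distrib sum_subtractf if_distrib[of "\<lambda>x. x * _"]
          sum.delta cong: if_cong)
    then have "(\<Sum>\<gamma>\<in>exponent_tuples n N. c \<gamma> * (\<Prod>i<n. g i a ^ \<gamma> i)) = 0" for a
      using fun_cong[OF ab(4), of a] by (simp add: G_def)
    then show thesis using ab(1,3) by (intro that[of \<alpha> N c]) (auto simp: c_def)
  next
    case True
    have "fun_space.dependent (G ` exponent_tuples n N)"
    proof (rule ccontr)
      assume "\<not> ?thesis"
      from fun_space.independent_span_bound[OF finB this G] have "card (G ` exponent_tuples n N) \<le> card B"
        by blast
      then show False using less card_image[OF True] by simp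
    qed
    then obtain u v where u: "v \<in> G ` exponent_tuples n N" "u v \<noteq> 0"
      "(\<Sum>v\<in>G ` exponent_tuples n N. (\<lambda>x. u v * v x)) = 0"
      using fun_space.dependent_finite[of "G ` exponent_tuples n N"] fin by auto
    obtain \<alpha> where \<alpha>: "\<alpha> \<in> exponent_tuples n N" "v = G \<alpha>" using u(1) by blast
    have sum_apply: "sum F A a = (\<Sum>v\<in>A. F v a)"
      for F :: "(('n \<Rightarrow> complex) \<Rightarrow> complex) \<Rightarrow> ('n \<Rightarrow> complex) \<Rightarrow> complex" and A a
      by (induction A rule: infinite_finite_induct) auto
    have "(\<Sum>\<alpha>\<in>exponent_tuples n N. u (G \<alpha>) * G \<alpha> a) = 0" for a
    proof -
      have "(\<Sum>\<alpha>\<in>exponent_tuples n N. u (G \<alpha>) * G \<alpha> a) = (\<Sum>v\<in>G ` exponent_tuples n N. u v * v a)"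
        by (simp add: sum.reindex[OF True])
      also have "\<dots> = (\<Sum>v\<in>G ` exponent_tuples n N. (\<lambda>x. u v * v x)) a"
        by (simp add: sum_apply)
      finally show ?thesis by (simp add: u(3))
    qed
    then show thesis using \<alpha> u(2) by (intro that[of \<alpha> N "\<lambda>\<alpha>. u (G \<alpha>)"]) (auto simp: G_def)
  qed
qed

text \<open>
  Each strict inclusion of closed sets is witnessed by a polynomial that vanishes on the smaller
  set but not on the larger; more than \<open>CARD('n)\<close> such polynomials would have both dependent and independent monomials.
\<close>

lemma chain_length_le_dim:
  fixes Z :: "nat \<Rightarrow> ('n::finite \<Rightarrow> complex) set"
  assumes Z: "\<And>i. i \<le> n \<Longrightarrow> closedin zariski (Z i) \<and> irreducible_subset zariski (Z i)"
    and less: "\<And>i. i < n \<Longrightarrow> Z i \<subset> Z (Suc i)"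
  shows "n \<le> CARD('n)"
proof (rule ccontr)
  assume "\<not> ?thesis"
  then have n: "CARD('n) < n" by simp
  have "\<forall>i\<in>{..<n}. \<exists>g. polyfun g \<and> (\<forall>z\<in>Z i. g z = 0) \<and> (\<exists>z\<in>Z (Suc i). g z \<noteq> 0)"
  proof
    fix i assume "i \<in> {..<n}"
    then have i: "i < n" by simp
    obtain S where S: "Z i = zero_locus S" using Z[of i] i by (auto simp: closedin_zariski)
    obtain z where z: "z \<in> Z (Suc i)" "z \<notin> Z i" using less[OF i] by blast
    then obtain p where "p \<in> S" "eval_poly p z \<noteq> 0" by (auto simp: S zero_locus_def)
    with z(1) show "\<exists>g. polyfun g \<and> (\<forall>z\<in>Z i. g z = 0) \<and> (\<exists>z\<in>Z (Suc i). g z \<noteq> 0)"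
      by (intro exI[of _ "eval_poly p"]) (auto simp: S zero_locus_def polyfun_eval_poly)
  qed
  then obtain g where g: "\<forall>i\<in>{..<n}. polyfun (g i) \<and> (\<forall>z\<in>Z i. g i z = 0) \<and>
      (\<exists>z\<in>Z (Suc i). g i z \<noteq> 0)" by (rule bchoice[THEN exE])
  obtain N c \<alpha> where c: "\<alpha> \<in> exponent_tuples n N" "c \<alpha> \<noteq> 0"
    "\<And>a. (\<Sum>\<alpha>\<in>exponent_tuples n N. c \<alpha> * (\<Prod>i<n. g i a ^ \<alpha> i)) = 0"
  proof (rule monomials_dependent[of n g])
    show "polyfun (g i)" if "i < n" for i using g that by simp
  qed (use n in simp_all)
  have "c \<alpha> = 0"
  proof (rule chain_monomials_independent[where Z=Z and g=g and n=n and N=N and c=c])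
    show "irreducible_subset zariski (Z i)" if "i \<le> n" for i using Z that by blast
    show "Z i \<subseteq> Z (Suc i)" if "i < n" for i using less that by blast
  qed (use g c in simp_all)
  with c(2) show False by simp
qed

theorem krull_dim_affine_space:
  "krull_dim (zariski :: ('n::finite \<Rightarrow> complex) topology) = enat CARD('n)"
proof (rule antisym)
  show "krull_dim (zariski :: ('n \<Rightarrow> complex) topology) \<le> enat CARD('n)"
    unfolding krull_dim_def
  proof (rule Sup_least)
    fix d assume "d \<in> {enat n |n. \<exists>Z :: nat \<Rightarrow> ('n \<Rightarrow> complex) set.
      (\<forall>i\<le>n. closedin zariski (Z i) \<and> irreducible_subset zariski (Z i)) \<and> (\<forall>i<n. Z i \<subset> Z (Suc i))}"
    then obtain n and Z :: "nat \<Rightarrow> ('n \<Rightarrow> complex) set" where d: "d = enat n"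
      and Z: "\<forall>i\<le>n. closedin zariski (Z i) \<and> irreducible_subset zariski (Z i)"
        "\<forall>i<n. Z i \<subset> Z (Suc i)"
      by blast
    have "n \<le> CARD('n)" by (rule chain_length_le_dim[of n Z]) (use Z in simp_all)
    then show "d \<le> enat CARD('n)" by (simp add: d)
  qed
next
  obtain idx :: "'n \<Rightarrow> nat" where idx: "bij_betw idx UNIV {..<CARD('n)}"
    using ex_bij_betw_finite_nat[of "UNIV :: 'n set"] by (auto simp: atLeast0LessThan)
  (* The flag of coordinate subspaces, each of which is the image of a coordinate projection. *)
  define Z where "Z k = {a :: 'n \<Rightarrow> complex. \<forall>v. k \<le> idx v \<longrightarrow> a v = 0}" for k
  have "closedin zariski (Z k)" for k
  proof -
    have "Z k = zero_locus (Var ` {v. k \<le> idx v})"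
      by (auto simp: Z_def zero_locus_def eval_poly_Var)
    then show ?thesis unfolding closedin_zariski by blast
  qed
  moreover have "irreducible_subset zariski (Z k)" for k
  proof -
    let ?\<pi> = "\<lambda>a v. if k \<le> idx v then 0 else a v :: complex"
    have "Z k = range ?\<pi>"
    proof
      show "Z k \<subseteq> range ?\<pi>"
      proof
        fix a assume "a \<in> Z k"
        then have "a = ?\<pi> a" by (auto simp: Z_def)
        then show "a \<in> range ?\<pi>" by blast
      qed
    qed (auto simp: Z_def)
    have "polyfun (\<lambda>a. ?\<pi> a v)" for v
      by (cases "k \<le> idx v") (auto intro: polyfun_intros)
    then have "continuous_map zariski zariski ?\<pi>" by (rule continuous_map_zariski)
    from irreducible_subset_continuous_image[OF this irreducible_affine_space]
    show ?thesis by (simp only: \<open>Z k = range ?\<pi>\<close>)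
  qed
  moreover have "Z k \<subset> Z (Suc k)" if "k < CARD('n)" for k
  proof -
    have "k \<in> range idx" using idx that by (simp add: bij_betw_def)
    then obtain v where v: "idx v = k" by blast
    have "(\<lambda>w. if w = v then 1 else 0) \<in> Z (Suc k) - Z k" using v by (auto simp: Z_def)
    moreover have "Z k \<subseteq> Z (Suc k)" by (auto simp: Z_def)
    ultimately show ?thesis by blast
  qed
  ultimately show "enat CARD('n) \<le> krull_dim (zariski :: ('n \<Rightarrow> complex) topology)"
    unfolding krull_dim_def
    by (intro Sup_upper CollectI exI[of _ "CARD('n)"] conjI exI[of _ Z]) simp_all
qed

section \<open>The two components as images of affine spaces\<close>

lemma zero_locus_ideal_gen: "zero_locus (ideal_gen S) = zero_locus S"
proof
  have "eval_poly (\<Sum>g\<in>G. h g * g) a = 0"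
    if "a \<in> zero_locus S" "finite G" "G \<subseteq> S" for a and G :: "'a mpoly set" and h
    using that(2,3)
  proof (induction G)
    case empty
    show ?case by (simp add: eval_poly_def)
  next
    case (insert g G)
    then show ?case using that(1) by (simp add: eval_poly_add eval_poly_mult zero_locus_def)
  qed
  then show "zero_locus S \<subseteq> zero_locus (ideal_gen S)"
    by (auto simp: ideal_gen_explicit zero_locus_def)
next
  have "S \<subseteq> ideal_gen S"
  proof
    fix p assume "p \<in> S"
    then show "p \<in> ideal_gen S"
      unfolding ideal_gen_explicit mem_Collect_eq
      by (intro exI[of _ "{p}"] exI[of _ "\<lambda>_. 1"]) simp
  qed
  then show "zero_locus (ideal_gen S) \<subseteq> zero_locus S" by (auto simp: zero_locus_def)
qed

lemma mem_zero_locus_p1: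
  "a \<in> zero_locus p1 \<longleftrightarrow>
     a (X 1 3) = 0 \<and> a (X 2 2) = 0 \<and> a (X 3 1) = 0 \<and> a Y = 0 \<and>
     a (X 3 3) = - a (X 1 1) \<and> a (X 1 2) = - 2 * a (X 2 3) \<and> a (X 2 1) = - a (X 3 2) / 2"
proof -
  have "x + y = 0 \<longleftrightarrow> y = - x" "x + 2 * y = 0 \<longleftrightarrow> x = - 2 * y" "x + 1 / 2 * y = 0 \<longleftrightarrow> x = - y / 2"
    for x y :: complex
    using eq_neg_iff_add_eq_0[of y x] eq_neg_iff_add_eq_0[of x "2 * y"]
      eq_neg_iff_add_eq_0[of x "1 / 2 * y"] by (simp_all add: add.commute)
  then show ?thesis
    unfolding p1_def zero_locus_ideal_gen
    by (simp add: zero_locus_def eval_poly_Var eval_poly_add eval_poly_mult eval_poly_Const)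
qed

lemma mem_zero_locus_p2:
  "a \<in> zero_locus p2 \<longleftrightarrow>
     a (X 1 1) = 0 \<and> a (X 1 2) = 0 \<and> a (X 1 3) = 0 \<and> a (X 2 2) = 0 \<and> a (X 2 3) = 0 \<and>
     a (X 3 3) = 0 \<and> a (X 2 1) = - a (X 3 2) / 2 \<and> a (X 3 1) = a (X 3 2) * a Y / 2"
proof -
  have "x + 1 / 2 * y = 0 \<longleftrightarrow> x = - y / 2" for x y :: complex
    using eq_neg_iff_add_eq_0[of x "1 / 2 * y"] by simp
  then show ?thesis
    unfolding p2_def zero_locus_ideal_gen
    by (simp add: zero_locus_def eval_poly_Var eval_poly_add eval_poly_diff eval_poly_mult
        eval_poly_Const)
qed

text \<open>
  The matrices are written in the convention of the coordinates, that is, row \<open>i\<close> lists the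
  coefficients of \<open>D(e\<^sub>i)\<close>.
\<close>

definition param1 :: "(3 \<Rightarrow> complex) \<Rightarrow> coord \<Rightarrow> complex" where
  "param1 t v = (case v of
     X i j \<Rightarrow> vector [vector [t 1, - 2 * t 2, 0],
                      vector [- t 3 / 2, 0, t 2],
                      vector [0, t 3, - t 1]] $ i $ j
   | Y \<Rightarrow> 0)"

definition param2 :: "(2 \<Rightarrow> complex) \<Rightarrow> coord \<Rightarrow> complex" where
  "param2 t v = (case v of
     X i j \<Rightarrow> vector [vector [0, 0, 0],
                      vector [- t 1 / 2, 0, 0],
                      vector [t 1 * t 2 / 2, t 1, 0]] $ i $ j
   | Y \<Rightarrow> t 2)"

text \<open>
  Like \<open>proj2\<close> below, a polynomial left inverse of the parametrization with the same index.
\<close>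

definition proj1 :: "(coord \<Rightarrow> complex) \<Rightarrow> 3 \<Rightarrow> complex" where
  "proj1 a k = (if k = 1 then a (X 1 1) else if k = 2 then a (X 2 3) else a (X 3 2))"

definition proj2 :: "(coord \<Rightarrow> complex) \<Rightarrow> 2 \<Rightarrow> complex" where
  "proj2 a k = (if k = 1 then a (X 3 2) else a Y)"

lemma coord_fun_eq_iff:
  "a = a' \<longleftrightarrow> (\<forall>i j. a (X i j) = a' (X i j)) \<and> a Y = a' Y"
  by (metis coord.exhaust ext)

lemma range_param1: "range param1 = zero_locus p1"
proof (intro set_eqI iffI)
  fix a assume "a \<in> zero_locus p1"
  then have "a = param1 (proj1 a)"
    by (simp add: mem_zero_locus_p1 param1_def proj1_def coord_fun_eq_iff forall_3)
  then show "a \<in> range param1" by blast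
qed (auto simp: mem_zero_locus_p1 param1_def)

lemma range_param2: "range param2 = zero_locus p2"
proof (intro set_eqI iffI)
  fix a assume "a \<in> zero_locus p2"
  then have "a = param2 (proj2 a)"
    by (simp add: mem_zero_locus_p2 param2_def proj2_def coord_fun_eq_iff forall_3)
  then show "a \<in> range param2" by blast
qed (auto simp: mem_zero_locus_p2 param2_def)

lemma polyfun_param1: "polyfun (\<lambda>t. param1 t v)"
proof (cases v)
  case (X i j)
  have "\<forall>i j. polyfun (\<lambda>t. param1 t (X i j))"
    by (simp add: param1_def forall_3 polyfun_intros)
  then show ?thesis using X by simp
qed (simp add: param1_def polyfun_const)

lemma polyfun_param2: "polyfun (\<lambda>t. param2 t v)"
proof (cases v)
  case (X i j)
  have "\<forall>i j. polyfun (\<lambda>t. param2 t (X i j))"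
    by (simp add: param2_def forall_3 polyfun_intros)
  then show ?thesis using X by simp
qed (simp add: param2_def polyfun_coord)

lemma polyfun_proj1: "polyfun (\<lambda>a. proj1 a k)"
  by (cases "k = 1"; cases "k = 2") (simp_all add: proj1_def polyfun_coord)

lemma polyfun_proj2: "polyfun (\<lambda>a. proj2 a k)"
  by (cases "k = 1") (simp_all add: proj2_def polyfun_coord)

lemma proj1_param1: "proj1 (param1 t) = t"
  by (simp add: fun_eq_iff forall_3 proj1_def param1_def)

lemma proj2_param2: "proj2 (param2 t) = t"
  by (simp add: fun_eq_iff forall_2 proj2_def param2_def)

lemma irreducible_zero_locus:
  "irreducible_subset zariski (zero_locus p1)" "irreducible_subset zariski (zero_locus p2)"
  unfolding range_param1[symmetric] range_param2[symmetric]
  by (intro irreducible_subset_continuous_image[OF continuous_map_zariski irreducible_affine_space]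
      polyfun_param1 polyfun_param2)+

section \<open>The variety of twisted derivations\<close>

lemma coords_matrix: "coords ((*v) M, sigma b) (X i j) = M $ j $ i"
  by (simp add: coords_def transpose_def)

text \<open>
  Every point of the coordinate space is the point of exactly one pair of a linear map and a
  \<open>sigma b\<close>, so conditions on pairs become conditions on points.
\<close>

lemma mem_coords_image:
  "a \<in> coords ` {(D, sigma b) | D b. Vector_Spaces.linear (*s) (*s) D \<and> P D b} \<longleftrightarrow>
     P ((*v) (\<chi> i j. a (X j i))) (a Y)"
proof
  assume "a \<in> coords ` {(D, sigma b) | D b. Vector_Spaces.linear (*s) (*s) D \<and> P D b}"
  then obtain D b where a: "a = coords (D, sigma b)" and D: "Vector_Spaces.linear (*s) (*s) D" "P D b"
    by blast
  have "(\<chi> i j. a (X j i)) = matrix D"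
    by (simp add: a coords_def transpose_def vec_eq_iff)
  then have "(*v) (\<chi> i j. a (X j i)) = D"
    using matrix_works[OF D(1)] by (simp add: fun_eq_iff)
  moreover have "a Y = b" by (simp add: a coords_Y)
  ultimately show "P ((*v) (\<chi> i j. a (X j i))) (a Y)" using D(2) by simp
next
  assume P: "P ((*v) (\<chi> i j. a (X j i))) (a Y)"
  have "a = coords ((*v) (\<chi> i j. a (X j i)), sigma (a Y))"
    unfolding coord_fun_eq_iff by (simp add: coords_matrix coords_Y)
  with P show "a \<in> coords ` {(D, sigma b) | D b. Vector_Spaces.linear (*s) (*s) D \<and> P D b}"
    using matrix_vector_mul_linear_gen by blast
qed

lemmas bracket_components = bracket_def sigma_def matrix_vector_mult_def sum_3 vec_eq_iff forall_3

text \<open>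
  Given the zero loci, the Leibniz rule is an identity in the coordinates of its arguments.
  Conversely it suffices to evaluate it at five pairs of basis vectors, of which the diagonal ones
  \<open>(e\<^sub>2, e\<^sub>2)\<close> and \<open>(e\<^sub>3, e\<^sub>3)\<close> separate the two components.
\<close>

lemma twisted_derivation_iff:
  "twisted_derivation (sigma (a Y)) ((*v) (\<chi> i j. a (X j i))) \<longleftrightarrow>
     a \<in> zero_locus p1 \<or> a \<in> zero_locus p2"
proof
  assume "a \<in> zero_locus p1 \<or> a \<in> zero_locus p2"
  then show "twisted_derivation (sigma (a Y)) ((*v) (\<chi> i j. a (X j i)))"
  proof
    assume "a \<in> zero_locus p1"
    then have "a (X 1 3) = 0" "a (X 2 2) = 0" "a (X 3 1) = 0" "a Y = 0"
      "a (X 3 3) = - a (X 1 1)" "a (X 1 2) = - 2 * a (X 2 3)" "a (X 3 2) = - 2 * a (X 2 1)"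
      by (simp_all add: mem_zero_locus_p1)
    then show ?thesis
      unfolding twisted_derivation_def
      by (simp add: bracket_components matrix_vector_mul_linear_gen algebra_simps)
  next
    assume "a \<in> zero_locus p2"
    then have "a (X 1 1) = 0" "a (X 1 2) = 0" "a (X 1 3) = 0" "a (X 2 2) = 0" "a (X 2 3) = 0"
      "a (X 3 3) = 0" "a (X 3 2) = - 2 * a (X 2 1)" "a (X 3 1) = - a (X 2 1) * a Y"
      by (simp_all add: mem_zero_locus_p2)
    then show ?thesis
      unfolding twisted_derivation_def
      by (simp add: bracket_components matrix_vector_mul_linear_gen power2_eq_square algebra_simps)
  qed
next
  let ?D = "(*v) (\<chi> i j. a (X j i)) :: sl2 \<Rightarrow> sl2" and ?b = "a Y"
  assume "twisted_derivation (sigma ?b) ?D"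
  then have eq: "?D (bracket (e_basis i) (e_basis j)) =
      bracket (?D (e_basis i)) (sigma ?b (e_basis j)) + bracket (e_basis i) (?D (e_basis j))" for i j
    by (simp add: twisted_derivation_def)
  note E = bracket_components e_basis_def axis_def
  note e21 = eq[of 2 1, simplified E, simplified]
  note e31 = eq[of 3 1, simplified E, simplified]
  note e32 = eq[of 3 2, simplified E, simplified]
  note e22 = eq[of 2 2, simplified E, simplified]
  note e33 = eq[of 3 3, simplified E, simplified]
  have zero: "a (X 1 3) = 0" "a (X 2 2) = 0" using e21 by simp_all
  have half: "a (X 2 1) = - a (X 3 2) / 2" "a (X 3 1) = a (X 3 2) * ?b / 2"
  proof -
    have "2 * a (X 2 1) = - a (X 3 2)" unfolding conjunct1[OF e31, symmetric] by simp
    then show "a (X 2 1) = - a (X 3 2) / 2" by (simp add: field_simps)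
    show "a (X 3 1) = a (X 3 2) * ?b / 2" using e32 by (simp add: field_simps)
  qed
  have "- a (X 3 3) = a (X 1 1)" using e31 zero by auto
  then have "a (X 3 3) = - a (X 1 1)" by (metis minus_minus)
  moreover have "a (X 1 2) = - 2 * a (X 2 3)" using e21 by simp
  (* D e2 commutes with b e1, and D e3 commutes with b^2 e1 + 2 b e2. *)
  moreover have "a (X 2 3) = 0 \<and> a (X 3 3) = 0" if "?b \<noteq> 0" using e22 e33 that by simp
  ultimately show "a \<in> zero_locus p1 \<or> a \<in> zero_locus p2"
    using zero half by (cases "?b = 0") (simp_all add: mem_zero_locus_p1 mem_zero_locus_p2)
qed

lemma coords_Der_sigma: "coords ` Der_sigma = zero_locus p1 \<union> zero_locus p2"
proof -
  have "Der_sigma = {(D, sigma b) | D b. Vector_Spaces.linear (*s) (*s) D \<and> twisted_derivation (sigma b) D}"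
    by (auto simp: Der_sigma_def twisted_derivation_def)
  then show ?thesis
    using mem_coords_image[of _ "\<lambda>D b. twisted_derivation (sigma b) D"]
    by (auto simp only: twisted_derivation_iff Un_iff)
qed

text \<open>
  As \<open>sigma 0\<close> is the identity, derivations are the twisted derivations with \<open>y = 0\<close>; the points of the
  second zero locus with \<open>y = 0\<close> lie in the first as well.
\<close>

lemma coords_Der: "coords ` Der = zero_locus p1"
proof -
  have der: "derivation D \<longleftrightarrow> twisted_derivation (sigma 0) D" for D
    by (simp add: derivation_def twisted_derivation_def sigma_0)
  have "Der = {(D, sigma b) | D b. Vector_Spaces.linear (*s) (*s) D \<and>
      (b = 0 \<and> twisted_derivation (sigma b) D)}"
    by (auto simp: Der_def der twisted_derivation_def)
  then have "a \<in> coords ` Der \<longleftrightarrow> a Y = 0 \<and> (a \<in> zero_locus p1 \<or> a \<in> zero_locus p2)" for a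
    using mem_coords_image[of a "\<lambda>D b. b = 0 \<and> twisted_derivation (sigma b) D"]
    by (simp only: twisted_derivation_iff)
  moreover have "a Y = 0 \<and> (a \<in> zero_locus p1 \<or> a \<in> zero_locus p2) \<longleftrightarrow> a \<in> zero_locus p1" for a
    by (auto simp: mem_zero_locus_p1 mem_zero_locus_p2)
  ultimately show ?thesis by blast
qed

lemma coords_matrix_family:
  "zero_locus p2 = coords `
      {((*v) (vector [vector [0, - a / 2, a * b / 2],
                      vector [0, 0, a],
                      vector [0, 0, 0]]), sigma b) | a b. True}"
    (is "_ = coords ` {(?D a b, sigma b) | a b. True}")
proof -
  have coords: "coords (?D a b, sigma b) = param2 (\<lambda>k. if k = 1 then a else b)" for a b
    unfolding coord_fun_eq_iff by (simp add: coords_matrix coords_Y param2_def forall_3)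
  have "range param2 = {param2 (\<lambda>k. if k = 1 then a else b) | a b. True}" (is "_ = ?R")
  proof
    show "range param2 \<subseteq> ?R"
    proof
      fix u assume "u \<in> range param2"
      then obtain t where t: "u = param2 t" by blast
      have "t = (\<lambda>k. if k = 1 then t 1 else t 2)" by (simp add: fun_eq_iff forall_2)
      then have "u = param2 (\<lambda>k. if k = 1 then t 1 else t 2)" using t by simp
      then show "u \<in> ?R" by blast
    qed
  qed blast
  also have "\<dots> = coords ` {(?D a b, sigma b) | a b. True}"
    unfolding coords[symmetric] by blast
  finally show ?thesis by (simp only: range_param2)
qed

lemma zero_loci_incomparable:
  "\<not> zero_locus p1 \<subseteq> zero_locus p2" "\<not> zero_locus p2 \<subseteq> zero_locus p1"
proof -
  have "param1 (\<lambda>_. 1) \<in> zero_locus p1 - zero_locus p2"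
    by (simp add: mem_zero_locus_p1 mem_zero_locus_p2 param1_def)
  then show "\<not> zero_locus p1 \<subseteq> zero_locus p2" by blast
  have "param2 (\<lambda>_. 1) \<in> zero_locus p2 - zero_locus p1"
    by (simp add: mem_zero_locus_p1 mem_zero_locus_p2 param2_def)
  then show "\<not> zero_locus p2 \<subseteq> zero_locus p1" by blast
qed

lemma krull_dim_zero_locus:
  "krull_dim (subtopology zariski (zero_locus p1)) = 3"
  "krull_dim (subtopology zariski (zero_locus p2)) = 2"
proof -
  have "(zariski :: (3 \<Rightarrow> complex) topology) homeomorphic_space subtopology zariski (range param1)"
    using polyfun_param1 polyfun_proj1 proj1_param1 by (rule homeomorphic_range_if_polynomial_retraction)
  from krull_dim_homeomorphic[OF this] show "krull_dim (subtopology zariski (zero_locus p1)) = 3"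
    by (simp add: range_param1 krull_dim_affine_space numeral_eq_enat)
  have "(zariski :: (2 \<Rightarrow> complex) topology) homeomorphic_space subtopology zariski (range param2)"
    using polyfun_param2 polyfun_proj2 proj2_param2 by (rule homeomorphic_range_if_polynomial_retraction)
  from krull_dim_homeomorphic[OF this] show "krull_dim (subtopology zariski (zero_locus p2)) = 2"
    by (simp add: range_param2 krull_dim_affine_space numeral_eq_enat)
qed

theorem theorem1p6:
  shows "(\<forall>b. sigma b \<in> inner_automorphisms) \<and>
    closedin zariski (coords ` Der_sigma) \<and>
    irreducible_components (subtopology zariski (coords ` Der_sigma))
      = {zero_locus p1, zero_locus p2} \<and>
    zero_locus p1 \<noteq> zero_locus p2 \<and>
    zero_locus p1 = coords ` Der \<and>
    krull_dim (subtopology zariski (zero_locus p1)) = 3 \<and>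
    krull_dim (subtopology zariski (zero_locus p2)) = 2 \<and>
    zero_locus p2 = coords `
      {((*v) (vector [vector [0, - a / 2, a * b / 2],
                      vector [0, 0, a],
                      vector [0, 0, 0]]), sigma b) | a b. True}"
proof (intro conjI krull_dim_zero_locus coords_matrix_family)
  show "\<forall>b. sigma b \<in> inner_automorphisms"
    by (simp add: sigma_eq_exp_ad inner_automorphisms.exp_ad)
  have closed: "closedin zariski (zero_locus p1)" "closedin zariski (zero_locus p2)"
    unfolding closedin_zariski by blast+
  then show "closedin zariski (coords ` Der_sigma)"
    unfolding coords_Der_sigma by (rule closedin_Un)
  show "irreducible_components (subtopology zariski (coords ` Der_sigma))
      = {zero_locus p1, zero_locus p2}"
    unfolding coords_Der_sigma
    by (intro irreducible_components_Un irreducible_zero_locus closed zero_loci_incomparable)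
  show "zero_locus p1 \<noteq> zero_locus p2" using zero_loci_incomparable by blast
  show "zero_locus p1 = coords ` Der" by (rule coords_Der[symmetric])
qed

end
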